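(* Let $(G,X)$ be a flow with $G$ compactly generated with compact generating set $\Gamma$, and with $\dim X=0$. If $(G,X)$ is pointwise product recurrent, i.e. every point of $X\times X$ is $\Gamma$-recurrent of type I under the flow $(G,X\times X)$, $t(x,y)=(tx,ty)$, then $(G,X)$ is pointwise regularly almost periodic and equicontinuous.
   Context: A Hausdorff para-topological group is a group with a Hausdorff topology for which multiplication $G\times G\to G$ is jointly continuous (inversion need not be continuous). A flow $(G,X)$ consists of a Hausdorff para-topological group $G$, a locally compact Hausdorff uniform space $X$ (uniformity $\mathscr{U}$), and a jointly continuous map $G\times X\to X$, $(t,x)\mapsto tx$, with $ex=x$ and $(st)x=s(tx)$, such that $\overline{Gx}$ is compact for every $x\in X$. $\mathfrak{N}_x$ is the neighborhood filter of $x$; $N_G(x,U)=\{t\in G: tx\in U\}$. $\dim X=0$ means $X$ has a base of clopen sets. $G$ is compactly generated if there is a compact $\Gamma\subseteq G$ (a generating set) with $e\in\Gamma=\Gamma^{-1}$ and $G=\bigcup_{r\ge1}\Gamma^r$. For a Hausdorff space $Y$, $2^Y$ is the collection of closed subsets; for a net $\{Y_i\}$ in $2^Y$, write $Y_i\rightharpoonup K$ if $K$ is the set of all $y\in Y$ for which there are a subnet $\{Y_{i_k}\}$ and $y_{i_k}\in Y_{i_k}$ with $y_{i_k}\to y$. For $g\ne e$ in $G$, $|g|$ is the least $r$ with $g\in\Gamma^r$, and $\boldsymbol{K}(g)=\Gamma^{|g|-1}g$ with $\Gamma^0=\{e\}$. A $\Gamma$-cone is a set $\boldsymbol{C}\subseteq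 G$ such that $\boldsymbol{K}(g_i)\rightharpoonup\boldsymbol{C}$ in $2^G$ for some net $\{g_i\}$ in $G\setminus\{e\}$ with $|g_i|\to\infty$ and $|g_i|\le|g_{i'}|$ whenever $i\le i'$. A point $z$ of a flow $(G,Z)$ is $\Gamma$-recurrent of type I if $\boldsymbol{C}z\cap U\ne\emptyset$ for every $\Gamma$-cone $\boldsymbol{C}$ and every neighborhood $U$ of $z$. A subset $A\subseteq G$ is syndetic if $G=K^{-1}A$ for some compact $K\subseteq G$. A point $x$ is regularly almost periodic if for every $U\in\mathfrak{N}_x$ the set $N_G(x,U)$ contains a syndetic normal subgroup of $G$; $(G,X)$ is pointwise regularly almost periodic if every point is. $(G,X)$ is equicontinuous if for every $x\in X$ and $\varepsilon\in\mathscr{U}$ there is $U\in\mathfrak{N}_x$ with $gU\subseteq\varepsilon[gx]$ for all $g\in G$, where $\varepsilon[y]=\{z:(y,z)\in\varepsilon\}$. *)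

theory Defs
  imports "HOL-Analysis.Analysis" "HOL-Algebra.Coset"
begin

text \<open>
  The acting group is a type of sort
  \<open>{group_add, topological_monoid_add, t2_space}\<close>: an arbitrary, not necessarily
  commutative, group written additively, with a Hausdorff topology for which the group
  operation is jointly continuous. Inversion is not assumed to be continuous (that would be
  \<open>topological_group_add\<close>). Thus \<open>s + t\<close>, \<open>0\<close> and \<open>- t\<close> stand for
  the product \<open>st\<close>, the neutral element \<open>e\<close> and the inverse of \<open>t\<close>.
\<close>

locale flow =
  fixes act :: "'g::{group_add, topological_monoid_add, t2_space}
                  \<Rightarrow> 'x::{uniform_space, t2_space} \<Rightarrow> 'x"
  assumes locally_compact: "locally_compact_space (euclidean :: 'x topology)"
    and continuous_act: "continuous_on UNIV (\<lambda>(t, x). act t x)"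
    and act_zero: "act 0 x = x"
    and act_add: "act (s + t) x = act s (act t x)"
    and compact_orbit_closure: "compact (closure (range (\<lambda>t. act t x)))"

definition prod_act :: "('g \<Rightarrow> 'x \<Rightarrow> 'x) \<Rightarrow> 'g \<Rightarrow> 'x \<times> 'x \<Rightarrow> 'x \<times> 'x" where
  "prod_act act t = (\<lambda>(x, y). (act t x, act t y))"

lemma flow_prod_act:
  assumes "flow act"
  shows "flow (prod_act act)"
proof -
  interpret flow act by (rule assms)
  show ?thesis
  proof
    show "locally_compact_space (euclidean :: ('b \<times> 'b) topology)"
      unfolding prod_topology_euclidean[symmetric] locally_compact_space_prod_topology
      using locally_compact by blast
    have c: "continuous_on UNIV (\<lambda>z. act (f z) (h z))"
      if "continuous_on UNIV f" "continuous_on UNIV h"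
      for f :: "'a \<times> 'b \<times> 'b \<Rightarrow> 'a" and h
      using continuous_on_compose2[OF continuous_act continuous_on_Pair[OF that]]
      by simp
    show "continuous_on UNIV (\<lambda>(t, z). prod_act act t z)"
      unfolding prod_act_def case_prod_unfold
      by (intro continuous_on_Pair c continuous_intros)
    show "prod_act act 0 z = z" for z
      by (simp add: prod_act_def act_zero split: prod.splits)
    show "prod_act act (s + t) z = prod_act act s (prod_act act t z)" for s t z
      by (simp add: prod_act_def act_add split: prod.splits)
    show "compact (closure (range (\<lambda>t. prod_act act t z)))" for z
    proof -
      obtain x y where z: "z = (x, y)" by fastforce
      define K where "K = closure (range (\<lambda>t. act t x)) \<times> closure (range (\<lambda>t. act t y))"
      have K: "compact K"
        unfolding K_def by (intro compact_Times compact_orbit_closure)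
      have "range (\<lambda>t. prod_act act t z) \<subseteq> K"
        using closure_subset by (fastforce simp: z K_def prod_act_def)
      moreover have "closed K"
        unfolding K_def by (intro closed_Times closed_closure)
      ultimately have "closure (range (\<lambda>t. prod_act act t z)) \<subseteq> K"
        by (rule closure_minimal)
      then show ?thesis
        using compact_Int_closed[OF K closed_closure] by (metis inf.absorb_iff2)
    qed
  qed
qed

definition zero_dimensional :: "'x::topological_space itself \<Rightarrow> bool" where
  "zero_dimensional _ \<longleftrightarrow>
     (\<exists>B :: 'x set set. topological_basis B \<and> (\<forall>b\<in>B. open b \<and> closed b))"

definition return_set :: "('g \<Rightarrow> 'x \<Rightarrow> 'x) \<Rightarrow> 'x \<Rightarrow> 'x set \<Rightarrow> 'g set" where
  "return_set act x U = {t. act t x \<in> U}"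

primrec set_power :: "'g::monoid_add set \<Rightarrow> nat \<Rightarrow> 'g set" where
  "set_power \<Gamma> 0 = {0}"
| "set_power \<Gamma> (Suc r) = \<Gamma> + set_power \<Gamma> r"

definition compact_generating_set :: "'g::{group_add, topological_space} set \<Rightarrow> bool" where
  "compact_generating_set \<Gamma> \<longleftrightarrow>
     compact \<Gamma> \<and> 0 \<in> \<Gamma> \<and> \<Gamma> = uminus ` \<Gamma> \<and> UNIV = (\<Union>r\<in>{1..}. set_power \<Gamma> r)"

definition glength :: "'g::monoid_add set \<Rightarrow> 'g \<Rightarrow> nat" where
  "glength \<Gamma> g = (LEAST r. g \<in> set_power \<Gamma> r)"

definition K_set :: "'g::monoid_add set \<Rightarrow> 'g \<Rightarrow> 'g set" where
  "K_set \<Gamma> g = set_power \<Gamma> (glength \<Gamma> g - 1) + {g}"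

text \<open>
  A net is a function on a directed set \<open>(I, r)\<close>, where \<open>(i, j) \<in> r\<close>
  means \<open>i \<le> j\<close>; \<open>net_filter I r\<close> is the filter of its tails.
\<close>

definition directed_set :: "'i set \<Rightarrow> 'i rel \<Rightarrow> bool" where
  "directed_set I r \<longleftrightarrow>
     I \<noteq> {} \<and> preorder_on I r \<and> (\<forall>i\<in>I. \<forall>j\<in>I. \<exists>k\<in>I. (i, k) \<in> r \<and> (j, k) \<in> r)"

definition net_filter :: "'i set \<Rightarrow> 'i rel \<Rightarrow> 'i filter" where
  "net_filter I r = (INF i\<in>I. principal {j\<in>I. (i, j) \<in> r})"

definition subnet_map :: "'j set \<Rightarrow> 'j rel \<Rightarrow> ('j \<Rightarrow> 'i) \<Rightarrow> 'i set \<Rightarrow> 'i rel \<Rightarrow> bool" where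
  "subnet_map J s \<phi> I r \<longleftrightarrow>
     directed_set J s \<and> \<phi> \<in> J \<rightarrow> I \<and> filterlim \<phi> (net_filter I r) (net_filter J s)"

text \<open>
  The set of all limits of points \<open>p j \<in> Y (\<phi> j)\<close> along subnets of the net \<open>Y\<close>.
  A definition cannot quantify over the type of the subnet's indices, so that type is fixed to
  \<open>'i \<times> 'y set\<close>. The lemmas \<open>set_net_limit_iff\<close> and \<open>set_net_limitI\<close>
  below show that no other index type gives more limit points.
\<close>

definition set_net_limit ::
    "'i set \<Rightarrow> 'i rel \<Rightarrow> ('i \<Rightarrow> 'y::topological_space set) \<Rightarrow> 'y set" where
  "set_net_limit I r Y =
     {y. \<exists>(J :: ('i \<times> 'y set) set) s \<phi> p.
           subnet_map J s \<phi> I r \<and> (\<forall>j\<in>J. p j \<in> Y (\<phi> j)) \<and> (p \<longlongrightarrow> y) (net_filter J s)}"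

lemma eventually_net_filter:
  assumes "directed_set I r"
  shows "eventually P (net_filter I r) \<longleftrightarrow> (\<exists>i\<in>I. \<forall>j\<in>I. (i, j) \<in> r \<longrightarrow> P j)"
proof -
  have tr: "trans r" and ne: "I \<noteq> {}"
    using assms by (auto simp: directed_set_def preorder_on_def)
  have "\<exists>k\<in>I. {j\<in>I. (k, j) \<in> r} \<subseteq> {j\<in>I. (a, j) \<in> r} \<inter> {j\<in>I. (b, j) \<in> r}"
    if "a \<in> I" "b \<in> I" for a b
  proof -
    obtain k where "k \<in> I" "(a, k) \<in> r" "(b, k) \<in> r"
      using assms \<open>a \<in> I\<close> \<open>b \<in> I\<close> unfolding directed_set_def by blast
    then show ?thesis
      using tr by (intro bexI[of _ k]) (auto dest: transD)
  qed
  then show ?thesis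
    unfolding net_filter_def
    by (subst eventually_INF_base[OF ne]) (auto simp: eventually_principal)
qed

lemma set_net_limit_necessary:
  assumes I: "directed_set I r" and sub: "subnet_map J s \<phi> I r"
    and p: "\<And>j. j \<in> J \<Longrightarrow> p j \<in> Y (\<phi> j)" and lim: "(p \<longlongrightarrow> y) (net_filter J s)"
    and U: "open U" "y \<in> U" and i: "i \<in> I"
  shows "\<exists>k\<in>I. (i, k) \<in> r \<and> Y k \<inter> U \<noteq> {}"
proof -
  have J: "directed_set J s" and maps: "\<phi> \<in> J \<rightarrow> I"
    and fl: "filterlim \<phi> (net_filter I r) (net_filter J s)"
    using sub by (auto simp: subnet_map_def)
  have "eventually (\<lambda>k. (i, k) \<in> r) (net_filter I r)"
    using i by (auto simp: eventually_net_filter[OF I])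
  with fl have "eventually (\<lambda>j. (i, \<phi> j) \<in> r) (net_filter J s)"
    by (auto simp: filterlim_iff)
  moreover have "eventually (\<lambda>j. p j \<in> U) (net_filter J s)"
    using lim U by (auto simp: tendsto_def)
  ultimately have "eventually (\<lambda>j. (i, \<phi> j) \<in> r \<and> p j \<in> U) (net_filter J s)"
    by (rule eventually_conj)
  then obtain j where "j \<in> J" and
      j: "\<forall>j'\<in>J. (j, j') \<in> s \<longrightarrow> (i, \<phi> j') \<in> r \<and> p j' \<in> U"
    by (auto simp: eventually_net_filter[OF J])
  moreover have "(j, j) \<in> s"
    using J \<open>j \<in> J\<close> by (auto simp: directed_set_def preorder_on_def refl_on_def)
  ultimately show ?thesis
    using p maps by (intro bexI[of _ "\<phi> j"]) (auto simp: Pi_iff)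
qed

lemma set_net_limit_iff:
  fixes Y :: "'i \<Rightarrow> 'y::topological_space set"
  assumes I: "directed_set I r"
  shows "y \<in> set_net_limit I r Y \<longleftrightarrow>
           (\<forall>U. open U \<longrightarrow> y \<in> U \<longrightarrow> (\<forall>i\<in>I. \<exists>k\<in>I. (i, k) \<in> r \<and> Y k \<inter> U \<noteq> {}))"
    (is "_ \<longleftrightarrow> ?R")
proof
  assume "y \<in> set_net_limit I r Y"
  then obtain J :: "('i \<times> 'y set) set" and s \<phi> p
    where "subnet_map J s \<phi> I r" "\<forall>j\<in>J. p j \<in> Y (\<phi> j)" "(p \<longlongrightarrow> y) (net_filter J s)"
    unfolding set_net_limit_def by blast
  then show ?R
    using set_net_limit_necessary[OF I, of J s \<phi> p Y y] by blast
next
  assume R: ?R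
  define J where "J = {(i, U). i \<in> I \<and> open U \<and> y \<in> U \<and> Y i \<inter> U \<noteq> {}}"
  define s where "s = {(a, b). a \<in> J \<and> b \<in> J \<and> (fst a, fst b) \<in> r \<and> snd b \<subseteq> snd a}"
  define p where "p = (\<lambda>(i, U). SOME z. z \<in> Y i \<inter> U)"
  have p: "p j \<in> Y (fst j) \<inter> snd j" if "j \<in> J" for j
    using that some_in_eq[of "Y (fst j) \<inter> snd j"] by (auto simp: J_def p_def)
  have rr: "refl_on I r" and tr: "trans r"
    using I by (auto simp: directed_set_def preorder_on_def)
  have J: "directed_set J s"
    unfolding directed_set_def
  proof (intro conjI ballI)
    obtain i where "i \<in> I" using I by (auto simp: directed_set_def)
    then show "J \<noteq> {}" using R[rule_format, of UNIV i] by (auto simp: J_def)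
    show "preorder_on J s"
      using rr tr unfolding preorder_on_def
      by (auto simp: s_def J_def refl_on_def intro!: transI dest: transD)
    fix a b assume ab: "a \<in> J" "b \<in> J"
    then have "fst a \<in> I" "fst b \<in> I" by (auto simp: J_def)
    then obtain k where k: "k \<in> I" "(fst a, k) \<in> r" "(fst b, k) \<in> r"
      using I unfolding directed_set_def by blast
    obtain l where l: "l \<in> I" "(k, l) \<in> r" "Y l \<inter> (snd a \<inter> snd b) \<noteq> {}"
    proof -
      have "open (snd a \<inter> snd b)" "y \<in> snd a \<inter> snd b" using ab by (auto simp: J_def)
      then show thesis using R k(1) that by blast
    qed
    have "(l, snd a \<inter> snd b) \<in> J" using l ab by (auto simp: J_def)
    moreover have "(fst a, l) \<in> r" "(fst b, l) \<in> r" using k l tr by (meson transD)+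
    ultimately show "\<exists>c\<in>J. (a, c) \<in> s \<and> (b, c) \<in> s"
      using ab by (intro bexI[of _ "(l, snd a \<inter> snd b)"]) (auto simp: s_def)
  qed
  have "subnet_map J s fst I r"
    unfolding subnet_map_def filterlim_iff eventually_net_filter[OF J] eventually_net_filter[OF I]
  proof (intro conjI allI impI J)
    show "fst \<in> J \<rightarrow> I" by (auto simp: J_def)
    fix P assume "\<exists>i\<in>I. \<forall>j\<in>I. (i, j) \<in> r \<longrightarrow> P j"
    then obtain i where i: "i \<in> I" "\<forall>j\<in>I. (i, j) \<in> r \<longrightarrow> P j" by blast
    obtain k where k: "k \<in> I" "(i, k) \<in> r" "Y k \<noteq> {}"
      using R[rule_format, of UNIV i] i by auto
    then have "(k, UNIV) \<in> J" by (auto simp: J_def)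
    moreover have "P (fst b)" if "((k, UNIV), b) \<in> s" for b
      using that i(2) k tr by (auto simp: s_def J_def dest: transD)
    ultimately show "\<exists>a\<in>J. \<forall>b\<in>J. (a, b) \<in> s \<longrightarrow> P (fst b)" by blast
  qed
  moreover have "(p \<longlongrightarrow> y) (net_filter J s)"
    unfolding tendsto_def eventually_net_filter[OF J]
  proof (intro allI impI)
    fix U assume U: "open U" "y \<in> U"
    obtain i where "i \<in> I" using I by (auto simp: directed_set_def)
    then obtain k where k: "k \<in> I" "Y k \<inter> U \<noteq> {}"
      using R U by blast
    then have "(k, U) \<in> J" using U by (auto simp: J_def)
    moreover have "p b \<in> U" if "((k, U), b) \<in> s" for b
      using p[of b] that by (auto simp: s_def)
    ultimately show "\<exists>a\<in>J. \<forall>b\<in>J. (a, b) \<in> s \<longrightarrow> p b \<in> U" by blast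
  qed
  ultimately show "y \<in> set_net_limit I r Y"
    using p unfolding set_net_limit_def by blast
qed

lemma set_net_limitI:
  assumes "directed_set I r" and "subnet_map J s \<phi> I r"
    and "\<And>j. j \<in> J \<Longrightarrow> p j \<in> Y (\<phi> j)" and "(p \<longlongrightarrow> y) (net_filter J s)"
  shows "y \<in> set_net_limit I r Y"
  unfolding set_net_limit_iff[OF assms(1)]
  using set_net_limit_necessary[OF assms] by blast

text \<open>
  Again the index type of the nets has to be fixed, here to \<open>'g \<times> 'g set\<close>;
  the lemma \<open>gamma_coneI\<close> below shows that nets over any other index type produce no
  further cones. The sets \<open>K_set \<Gamma> (g i)\<close> are compact for compact \<open>\<Gamma>\<close>,
  so they do form a net of closed subsets.
\<close>

definition gamma_net ::
    "'g::monoid_add set \<Rightarrow> 'i set \<Rightarrow> 'i rel \<Rightarrow> ('i \<Rightarrow> 'g) \<Rightarrow> bool" where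
  "gamma_net \<Gamma> I r g \<longleftrightarrow>
     directed_set I r \<and> (\<forall>i\<in>I. g i \<noteq> 0) \<and>
     filterlim (\<lambda>i. glength \<Gamma> (g i)) at_top (net_filter I r) \<and>
     (\<forall>(i, j)\<in>r. glength \<Gamma> (g i) \<le> glength \<Gamma> (g j))"

definition gamma_cone ::
    "'g::{monoid_add, topological_space} set \<Rightarrow> 'g set \<Rightarrow> bool" where
  "gamma_cone \<Gamma> C \<longleftrightarrow>
     (\<exists>(I :: ('g \<times> 'g set) set) r g.
        gamma_net \<Gamma> I r g \<and> C = set_net_limit I r (\<lambda>i. K_set \<Gamma> (g i)))"

lemma gamma_coneI:
  fixes g :: "'i \<Rightarrow> 'g::{monoid_add, topological_space}"
  assumes net: "gamma_net \<Gamma> I r g"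
  shows "gamma_cone \<Gamma> (set_net_limit I r (\<lambda>i. K_set \<Gamma> (g i)))"
proof -
  have I: "directed_set I r" and g0: "\<And>i. i \<in> I \<Longrightarrow> g i \<noteq> 0"
    and lim: "filterlim (\<lambda>i. glength \<Gamma> (g i)) at_top (net_filter I r)"
    and mono: "\<And>i j. (i, j) \<in> r \<Longrightarrow> glength \<Gamma> (g i) \<le> glength \<Gamma> (g j)"
    using net by (auto simp: gamma_net_def)
  have rI: "r \<subseteq> I \<times> I" and rr: "\<And>i. i \<in> I \<Longrightarrow> (i, i) \<in> r"
    and tr: "\<And>i j k. (i, j) \<in> r \<Longrightarrow> (j, k) \<in> r \<Longrightarrow> (i, k) \<in> r"
    using I by (auto simp: directed_set_def preorder_on_def refl_on_def dest: transD)
  have dir: "\<exists>k. (i, k) \<in> r \<and> (j, k) \<in> r" if "i \<in> I" "j \<in> I" for i j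
    using I that unfolding directed_set_def by blast
  have large: "\<exists>k. (i, k) \<in> r \<and> n \<le> glength \<Gamma> (g k)" if "i \<in> I" for i n
  proof -
    obtain l where l: "l \<in> I" "\<forall>j\<in>I. (l, j) \<in> r \<longrightarrow> n \<le> glength \<Gamma> (g j)"
      using lim unfolding filterlim_at_top eventually_net_filter[OF I] by blast
    then show ?thesis using dir[OF that l(1)] rI by blast
  qed
  define T where "T i = {g k | k. (i, k) \<in> r}" for i
  have Tsub: "T j \<subseteq> T i" if "(i, j) \<in> r" for i j
    using that tr by (auto simp: T_def)
  have gT: "g k \<in> T k" if "k \<in> I" for k
    using rr[OF that] by (auto simp: T_def)
  define J where "J = {(h, T i) | h i. i \<in> I \<and> h \<in> T i}"
  define s where "s = {(a, b). a \<in> J \<and> b \<in> J \<and> snd b \<subseteq> snd a \<and>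
                         glength \<Gamma> (fst a) \<le> glength \<Gamma> (fst b)}"
  have J: "directed_set J s"
    unfolding directed_set_def
  proof (intro conjI ballI)
    obtain i where "i \<in> I" using I by (auto simp: directed_set_def)
    then show "J \<noteq> {}" using gT by (auto simp: J_def)
    show "preorder_on J s"
      unfolding preorder_on_def by (auto simp: s_def refl_on_def intro!: transI)
    fix a b assume ab: "a \<in> J" "b \<in> J"
    then obtain i j where i: "i \<in> I" "snd a = T i" and j: "j \<in> I" "snd b = T j"
      by (auto simp: J_def)
    obtain l where l: "(i, l) \<in> r" "(j, l) \<in> r" using dir[OF i(1) j(1)] by blast
    then have "l \<in> I" using rI by blast
    then obtain k where
      k: "(l, k) \<in> r" "max (glength \<Gamma> (fst a)) (glength \<Gamma> (fst b)) \<le> glength \<Gamma> (g k)"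
      using large by blast
    have kI: "k \<in> I" using k rI by blast
    then have "(g k, T k) \<in> J" using gT by (auto simp: J_def)
    moreover have "T k \<subseteq> T i" "T k \<subseteq> T j" using Tsub tr k l by blast+
    ultimately show "\<exists>c\<in>J. (a, c) \<in> s \<and> (b, c) \<in> s"
      using ab i j k by (intro bexI[of _ "(g k, T k)"]) (auto simp: s_def)
  qed
  have "gamma_net \<Gamma> J s fst"
    unfolding gamma_net_def filterlim_at_top eventually_net_filter[OF J]
  proof (intro conjI allI J)
    show "\<forall>i\<in>J. fst i \<noteq> 0" using g0 rI by (auto simp: J_def T_def)
    show "\<forall>(i, j)\<in>s. glength \<Gamma> (fst i) \<le> glength \<Gamma> (fst j)" by (auto simp: s_def)
    fix n
    obtain i where "i \<in> I" using I by (auto simp: directed_set_def)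
    then obtain k where k: "k \<in> I" "n \<le> glength \<Gamma> (g k)" using large rI by blast
    then have "(g k, T k) \<in> J" using gT by (auto simp: J_def)
    moreover have "n \<le> glength \<Gamma> (fst b)" if "((g k, T k), b) \<in> s" for b
      using that k by (auto simp: s_def)
    ultimately show "\<exists>a\<in>J. \<forall>b\<in>J. (a, b) \<in> s \<longrightarrow> n \<le> glength \<Gamma> (fst b)"
      by blast
  qed
  moreover have "set_net_limit I r (\<lambda>i. K_set \<Gamma> (g i)) =
                 set_net_limit J s (\<lambda>j. K_set \<Gamma> (fst j))"
  proof (intro Set.set_eqI iffI)
    fix y assume y: "y \<in> set_net_limit I r (\<lambda>i. K_set \<Gamma> (g i))"
    show "y \<in> set_net_limit J s (\<lambda>j. K_set \<Gamma> (fst j))"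
      unfolding set_net_limit_iff[OF J]
    proof (intro allI impI ballI)
      fix U a assume U: "open U" "y \<in> U" and a: "a \<in> J"
      then obtain i where i: "i \<in> I" "snd a = T i" by (auto simp: J_def)
      obtain l where l: "(i, l) \<in> r" "glength \<Gamma> (fst a) \<le> glength \<Gamma> (g l)"
        using large[OF i(1)] by blast
      then have "l \<in> I" using rI by blast
      then obtain k where k: "k \<in> I" "(l, k) \<in> r" "K_set \<Gamma> (g k) \<inter> U \<noteq> {}"
        using y U unfolding set_net_limit_iff[OF I] by blast
      have "(g k, T k) \<in> J" using gT k by (auto simp: J_def)
      moreover have "T k \<subseteq> T i" using Tsub tr k l by blast
      moreover have "glength \<Gamma> (fst a) \<le> glength \<Gamma> (g k)" using mono[OF k(2)] l by simp
      ultimately show "\<exists>b\<in>J. (a, b) \<in> s \<and> K_set \<Gamma> (fst b) \<inter> U \<noteq> {}"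
        using a i k by (intro bexI[of _ "(g k, T k)"]) (auto simp: s_def)
    qed
  next
    fix y assume y: "y \<in> set_net_limit J s (\<lambda>j. K_set \<Gamma> (fst j))"
    show "y \<in> set_net_limit I r (\<lambda>i. K_set \<Gamma> (g i))"
      unfolding set_net_limit_iff[OF I]
    proof (intro allI impI ballI)
      fix U i assume U: "open U" "y \<in> U" and i: "i \<in> I"
      then have "(g i, T i) \<in> J" using gT by (auto simp: J_def)
      then obtain b where b: "b \<in> J" "((g i, T i), b) \<in> s" "K_set \<Gamma> (fst b) \<inter> U \<noteq> {}"
        using y U unfolding set_net_limit_iff[OF J] by blast
      then have "fst b \<in> T i" by (auto simp: s_def J_def)
      then obtain k where "(i, k) \<in> r" "fst b = g k" by (auto simp: T_def)
      then show "\<exists>k\<in>I. (i, k) \<in> r \<and> K_set \<Gamma> (g k) \<inter> U \<noteq> {}"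
        using b rI by (intro bexI[of _ k]) auto
    qed
  qed
  ultimately show ?thesis unfolding gamma_cone_def by blast
qed

definition recurrent_type_I ::
    "'g::{monoid_add, topological_space} set
       \<Rightarrow> ('g \<Rightarrow> 'z::topological_space \<Rightarrow> 'z) \<Rightarrow> 'z \<Rightarrow> bool" where
  "recurrent_type_I \<Gamma> act z \<longleftrightarrow>
     (\<forall>C U. gamma_cone \<Gamma> C \<longrightarrow> (\<forall>\<^sub>F y in nhds z. y \<in> U) \<longrightarrow>
            (\<lambda>t. act t z) ` C \<inter> U \<noteq> {})"

definition pointwise_product_recurrent ::
    "'g::{monoid_add, topological_space} set
       \<Rightarrow> ('g \<Rightarrow> 'x::topological_space \<Rightarrow> 'x) \<Rightarrow> bool" where
  "pointwise_product_recurrent \<Gamma> act \<longleftrightarrow> (\<forall>z. recurrent_type_I \<Gamma> (prod_act act) z)"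

text \<open>The group type as a group record, for access to normal subgroups.\<close>

definition group_of_type :: "'g::group_add monoid" where
  "group_of_type = \<lparr>carrier = UNIV, monoid.mult = (+), one = 0\<rparr>"

lemma group_group_of_type: "group (group_of_type :: 'g::group_add monoid)"
  by (rule groupI) (auto simp: group_of_type_def add.assoc intro: left_minus)

definition syndetic :: "'g::{group_add, topological_space} set \<Rightarrow> bool" where
  "syndetic A \<longleftrightarrow> (\<exists>K. compact K \<and> UNIV = uminus ` K + A)"

definition regularly_almost_periodic ::
    "('g::{group_add, topological_space} \<Rightarrow> 'x::topological_space \<Rightarrow> 'x) \<Rightarrow> 'x \<Rightarrow> bool" where
  "regularly_almost_periodic act x \<longleftrightarrow>
     (\<forall>U. (\<forall>\<^sub>F y in nhds x. y \<in> U) \<longrightarrow>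
        (\<exists>H. H \<lhd> group_of_type \<and> syndetic H \<and> H \<subseteq> return_set act x U))"

definition pointwise_regularly_almost_periodic ::
    "('g::{group_add, topological_space} \<Rightarrow> 'x::topological_space \<Rightarrow> 'x) \<Rightarrow> bool" where
  "pointwise_regularly_almost_periodic act \<longleftrightarrow> (\<forall>x. regularly_almost_periodic act x)"

text \<open>A set \<open>\<epsilon>\<close> is an entourage if it belongs to the filter \<open>uniformity\<close>.\<close>

definition equicontinuous_action :: "('g \<Rightarrow> 'x::uniform_space \<Rightarrow> 'x) \<Rightarrow> bool" where
  "equicontinuous_action act \<longleftrightarrow>
     (\<forall>x \<epsilon>. (\<forall>\<^sub>F p in uniformity. p \<in> \<epsilon>) \<longrightarrow>
        (\<exists>U. (\<forall>\<^sub>F y in nhds x. y \<in> U) \<and> (\<forall>g. act g ` U \<subseteq> \<epsilon> `` {act g x})))"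

end

theory Submission
  imports Defs
begin

text \<open>
  The heart of the matter is that in a pointwise recurrent flow the set \<open>V*\<close> of points whose
  whole orbit stays in a compact open set \<open>V\<close> is open. Otherwise points arbitrarily close to
  some point of \<open>V*\<close> are moved out of \<open>V\<close>, first by elements \<open>g\<close> of
  arbitrarily large length; the exit points \<open>g z\<close> lie in the compact set
  \<open>\<Gamma>V - V\<close>, and \<open>\<^bold>K(g\<^sup>-\<^sup>1)\<close> moves \<open>g z\<close> into \<open>V\<close>. A
  cluster point \<open>y\<close> of exit points is therefore moved into \<open>V\<close> by a whole cone,
  although \<open>y\<close> is not in \<open>V\<close>.

  For \<open>V\<close> a compact open neighbourhood of an orbit closure this yields compact open invariant
  sets \<open>Y\<close>. In \<open>X \<times> X\<close>, the choice of \<open>V\<close> as a small neighbourhood of the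
  diagonal of \<open>Y\<close> gives equicontinuity. For a clopen partition of \<open>Y\<close> into two pieces,
  with \<open>V\<close> the set of pairs in the same piece, \<open>V*\<close> is an open invariant equivalence
  relation. It has finitely many classes, and the kernel of the action on these is the required
  normal subgroup.
\<close>

section \<open>Word length\<close>

lemma set_power_add: "set_power \<Gamma> (m + n) = set_power \<Gamma> m + set_power \<Gamma> n"
  by (induction m) (simp_all add: add.assoc flip: set_zero)

lemma set_power_mono:
  assumes "0 \<in> \<Gamma>" "m \<le> n"
  shows "set_power \<Gamma> m \<subseteq> set_power \<Gamma> n"
proof -
  have "0 \<in> set_power \<Gamma> k" for k
    using assms(1) by (induction k) (use set_plus_intro in fastforce)+
  then have "0 \<in> set_power \<Gamma> (n - m)" .
  then have "set_power \<Gamma> m \<subseteq> set_power \<Gamma> (n - m) + set_power \<Gamma> m"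
    using set_plus_intro[of 0 "set_power \<Gamma> (n - m)"] by fastforce
  then show ?thesis
    using assms(2) by (simp flip: set_power_add)
qed

lemma uminus_set_power:
  fixes \<Gamma> :: "'g::group_add set"
  assumes "\<Gamma> = uminus ` \<Gamma>" "g \<in> set_power \<Gamma> r"
  shows "- g \<in> set_power \<Gamma> r"
  using assms(2)
proof (induction r arbitrary: g)
  case (Suc r)
  then obtain a h where g: "g = a + h" "a \<in> \<Gamma>" "h \<in> set_power \<Gamma> r"
    by (auto elim: set_plus_elim)
  \<comment> \<open>Inversion turns \<open>a + h\<close> into \<open>- h + - a\<close>: the letter
    moves to the right end, while \<open>set_power\<close> adds letters on the left. Additivity in
    the exponent repairs this.\<close>
  have "- a \<in> set_power \<Gamma> 1"
    using g(2) assms(1) by (auto simp flip: set_zero)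
  then have "- h + - a \<in> set_power \<Gamma> (r + 1)"
    unfolding set_power_add using Suc.IH[OF g(3)] by (intro set_plus_intro)
  then show ?case
    by (simp add: g(1) minus_add)
qed simp

text \<open>Exit elements are measured by length, but the cone below comes from the net of their
  inverses.\<close>

lemma glength_uminus:
  fixes \<Gamma> :: "'g::group_add set"
  assumes "\<Gamma> = uminus ` \<Gamma>"
  shows "glength \<Gamma> (- g) = glength \<Gamma> g"
proof -
  have "- g \<in> set_power \<Gamma> r \<longleftrightarrow> g \<in> set_power \<Gamma> r" for r
    using uminus_set_power[OF assms, of g] uminus_set_power[OF assms, of "- g"] by auto
  then show ?thesis
    by (simp add: glength_def)
qed

lemma glength_le: "g \<in> set_power \<Gamma> r \<Longrightarrow> glength \<Gamma> g \<le> r"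
  unfolding glength_def by (rule Least_le)

lemma set_power_glength:
  assumes "compact_generating_set \<Gamma>"
  shows "g \<in> set_power \<Gamma> (glength \<Gamma> g)"
proof -
  have "\<exists>r. g \<in> set_power \<Gamma> r"
    using assms by (auto simp: compact_generating_set_def)
  then show ?thesis
    unfolding glength_def by (rule LeastI_ex)
qed

lemma compact_set_power:
  fixes \<Gamma> :: "'g::topological_monoid_add set"
  assumes "compact \<Gamma>"
  shows "compact (set_power \<Gamma> r)"
proof (induction r)
  case (Suc r)
  have "\<Gamma> + set_power \<Gamma> r = (\<lambda>(a, b). a + b) ` (\<Gamma> \<times> set_power \<Gamma> r)"
    by (force simp: set_plus_def)
  moreover have "continuous_on (\<Gamma> \<times> set_power \<Gamma> r) (\<lambda>(a, b). a + b)"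
    unfolding case_prod_unfold by (intro continuous_intros)
  ultimately show ?case
    using compact_continuous_image[OF _ compact_Times[OF assms Suc]] by simp
qed simp

section \<open>Points whose orbits stay in a compact open set\<close>

context flow
begin

lemma act_minus [simp]: "act (- g) (act g x) = x" "act g (act (- g) x) = x"
  by (simp_all add: act_zero flip: act_add)

lemma act_nhds:
  assumes "open W" "act g x \<in> W"
  obtains A B where "open A" "open B" "g \<in> A" "x \<in> B"
    "\<And>a b. a \<in> A \<Longrightarrow> b \<in> B \<Longrightarrow> act a b \<in> W"
proof -
  have "open ((\<lambda>(t, x). act t x) -` W)"
    using continuous_act assms(1) by (simp add: continuous_on_open_vimage)
  then obtain A B where "open A" "open B" "(g, x) \<in> A \<times> B" "A \<times> B \<subseteq> (\<lambda>(t, x). act t x) -` W"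
    using assms(2) by (elim open_prod_elim[where x = "(g, x)"]) auto
  moreover have "act a b \<in> W" if "a \<in> A" "b \<in> B" for a b
    using that subsetD[OF \<open>A \<times> B \<subseteq> _\<close>, of "(a, b)"] by simp
  ultimately show thesis
    using that by blast
qed

text \<open>Tube-lemma argument: joint continuity gives neighbourhoods of each \<open>g\<close> in
  \<open>K\<close> and of \<open>x\<close>; finitely many of the former cover
  \<open>K\<close>.\<close>

lemma eventually_act_compact:
  assumes "compact K" "open V" "\<And>g. g \<in> K \<Longrightarrow> act g x \<in> V"
  shows "\<forall>\<^sub>F y in nhds x. \<forall>g\<in>K. act g y \<in> V"
proof -
  have "\<exists>A. g \<in> A \<and> open A \<and> (\<forall>\<^sub>F y in nhds x. \<forall>g\<in>A. act g y \<in> V)" if g: "g \<in> K" for g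
  proof -
    obtain A B where "open A" "open B" "g \<in> A" "x \<in> B" "\<And>a b. a \<in> A \<Longrightarrow> b \<in> B \<Longrightarrow> act a b \<in> V"
      using act_nhds[OF assms(2) assms(3)[OF g]] by metis
    then show ?thesis
      by (auto simp: eventually_nhds)
  qed
  then have "\<forall>g\<in>K. \<exists>A. g \<in> A \<and> open A \<and> (\<forall>\<^sub>F y in nhds x. \<forall>g\<in>A. act g y \<in> V)"
    by blast
  then obtain A where A: "\<And>g. g \<in> K \<Longrightarrow> g \<in> A g" "\<And>g. g \<in> K \<Longrightarrow> open (A g)"
      "\<And>g. g \<in> K \<Longrightarrow> \<forall>\<^sub>F y in nhds x. \<forall>g\<in>A g. act g y \<in> V"
    unfolding bchoice_iff by blast
  obtain F where F: "F \<subseteq> K" "finite F" "K \<subseteq> (\<Union>g\<in>F. A g)"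
    using compactE_image[OF assms(1), of K A] A(1,2) by blast
  have "\<forall>\<^sub>F y in nhds x. \<forall>h\<in>F. \<forall>g\<in>A h. act g y \<in> V"
    using A(3) F(1) by (intro eventually_ball_finite F(2)) auto
  then show ?thesis
    by (rule eventually_mono) (use F(3) in blast)
qed

lemma open_orbit_in:
  assumes \<Gamma>: "compact_generating_set \<Gamma>" and rec: "\<And>z. recurrent_type_I \<Gamma> act z"
    and V: "open V" "compact V"
  shows "open {z. \<forall>g. act g z \<in> V}"
proof (rule ccontr)
  assume "\<not> ?thesis"
  then obtain z where z: "\<And>g. act g z \<in> V" and nz: "\<not> (\<forall>\<^sub>F y in nhds z. \<forall>g. act g y \<in> V)"
    unfolding open_subopen[of "{z. \<forall>g. act g z \<in> V}"] eventually_nhds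
    by (smt (verit, best) mem_Collect_eq subsetI)
  have cG: "compact \<Gamma>" and G0: "0 \<in> \<Gamma>" and Gm: "\<Gamma> = uminus ` \<Gamma>"
    using \<Gamma> by (auto simp: compact_generating_set_def)
  have clV: "closed V"
    using V(2) by (rule compact_imp_closed)
  let ?l = "glength \<Gamma>"
  \<comment> \<open>In such a pair, \<open>g\<close> is a shortest element taking \<open>x\<close>
    out of \<open>V\<close>.\<close>
  define P where
    "P = {(x, g). x \<in> V \<and> act g x \<notin> V \<and> (\<forall>h. ?l h < ?l g \<longrightarrow> act h x \<in> V)}"
  have P: "\<exists>x g. (x, g) \<in> P \<and> n \<le> ?l g" for n
  proof -
    \<comment> \<open>Near \<open>z\<close> no element of \<open>set_power \<Gamma> n\<close> leads
      out of \<open>V\<close>, yet \<open>nz\<close> supplies a point there that does leave; its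
      shortest exit element has length at least \<open>n\<close>.\<close>
    have "\<forall>\<^sub>F y in nhds z. \<forall>g\<in>set_power \<Gamma> n. act g y \<in> V"
      using z by (intro eventually_act_compact compact_set_power cG V(1)) auto
    with nz obtain x where x: "\<And>g. g \<in> set_power \<Gamma> n \<Longrightarrow> act g x \<in> V" "\<exists>g. act g x \<notin> V"
      by (smt (verit, best) eventually_mono)
    obtain g where g: "act g x \<notin> V" "\<And>h. act h x \<notin> V \<Longrightarrow> ?l g \<le> ?l h"
      using x(2) exists_least_iff[of "\<lambda>m. \<exists>g. act g x \<notin> V \<and> ?l g = m"] by (metis not_less)
    have "n \<le> ?l g"
      using x(1)[of g] g(1) set_power_mono[OF G0, of "?l g" n] set_power_glength[OF \<Gamma>, of g]
      by force
    moreover have "x \<in> V"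
      using x(1)[of 0] set_power_mono[OF G0, of 0 n] by (simp add: act_zero)
    ultimately show ?thesis
      using g by (intro exI[of _ x] exI[of _ g]) (auto simp: P_def not_less[symmetric])
  qed
  have nonzero: "g \<noteq> 0" if "(x, g) \<in> P" for x g
    using that by (auto simp: P_def act_zero)
  \<comment> \<open>Writing \<open>g\<close> as a letter times a shorter word \<open>h\<close> shows
    that the exit point lies in \<Gamma>V, since \<open>h\<close> keeps \<open>x\<close> in
    \<open>V\<close>. Removing the open set \<open>V\<close> leaves a compact set.\<close>
  define L where "L = (\<lambda>(t, x). act t x) ` (\<Gamma> \<times> V) - V"
  have L: "act g x \<in> L" if "(x, g) \<in> P" for x g
  proof -
    have "?l g \<noteq> 0"
      using set_power_glength[OF \<Gamma>, of g] nonzero[OF that] by (metis set_power.simps(1) singletonD)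
    then obtain r where r: "?l g = Suc r"
      using not0_implies_Suc by blast
    then obtain a h where ah: "g = a + h" "a \<in> \<Gamma>" "h \<in> set_power \<Gamma> r"
      using set_power_glength[OF \<Gamma>, of g] by (auto elim: set_plus_elim)
    have "act h x \<in> V"
      using that glength_le[OF ah(3)] r by (auto simp: P_def)
    then show ?thesis
      using that ah by (force simp: L_def P_def act_add)
  qed
  \<comment> \<open>These sets decrease and are nonempty subsets of the compact \<open>L\<close>, so
    their closures share a point of \<open>L\<close>.\<close>
  define F where "F n = {act g x | x g. (x, g) \<in> P \<and> n \<le> ?l g}" for n
  have "\<exists>y\<in>L. \<forall>n. y \<in> closure (F n)"
  proof (rule ccontr)
    assume "\<not> ?thesis"
    then have cov: "L \<subseteq> (\<Union>n\<in>UNIV. - closure (F n))"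
      by auto
    have "continuous_on (\<Gamma> \<times> V) (\<lambda>(t, x). act t x)"
      using continuous_act by (rule continuous_on_subset) simp
    then have cL: "compact L"
      unfolding L_def by (intro compact_diff compact_continuous_image compact_Times cG V)
    obtain N where N: "finite N" "L \<subseteq> (\<Union>n\<in>N. - closure (F n))"
      by (rule compactE_image[OF cL _ cov]) auto
    obtain x g where xg: "(x, g) \<in> P" "Max (insert 0 N) \<le> ?l g"
      using P by blast
    obtain n where "n \<in> N" "act g x \<notin> closure (F n)"
      using N(2) L[OF xg(1)] by blast
    moreover have "n \<le> ?l g"
      using xg(2) N(1) \<open>n \<in> N\<close> by (meson Max_ge finite.insertI insertI2 order_trans)
    ultimately show False
      using xg(1) closure_subset[of "F n"] by (auto simp: F_def)
  qed
  then obtain y where y: "y \<in> L" "\<And>n. y \<in> closure (F n)"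
    by blast
  \<comment> \<open>The component \<open>W\<close> forces the exit points to converge to
    \<open>y\<close>; ordering by length yields the monotonicity that \<open>gamma_net\<close>
    demands.\<close>
  define I where "I = {(x, g, W). (x, g) \<in> P \<and> open W \<and> y \<in> W \<and> act g x \<in> W}"
  define r where "r = {(i, j). i \<in> I \<and> j \<in> I \<and> ?l (fst (snd i)) \<le> ?l (fst (snd j))
                                \<and> snd (snd j) \<subseteq> snd (snd i)}"
  have ex: "\<exists>x g. (x, g, W) \<in> I \<and> n \<le> ?l g" if W: "open W" "y \<in> W" for W n
  proof -
    obtain w where "w \<in> W" "w \<in> F n"
      using y(2)[of n] W open_Int_closure_eq_empty[of W "F n"] by blast
    then show ?thesis
      using W by (auto simp: I_def F_def)
  qed
  have I: "directed_set I r"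
    unfolding directed_set_def
  proof (intro conjI ballI)
    show "I \<noteq> {}"
      using ex[of UNIV 0] by auto
    show "preorder_on I r"
      unfolding preorder_on_def by (auto simp: r_def refl_on_def intro!: transI)
    fix i j assume ij: "i \<in> I" "j \<in> I"
    obtain x1 g1 W1 x2 g2 W2 where i: "i = (x1, g1, W1)" and j: "j = (x2, g2, W2)"
      by (metis prod_cases3)
    obtain x g where "(x, g, W1 \<inter> W2) \<in> I" "max (?l g1) (?l g2) \<le> ?l g"
      using ex[of "W1 \<inter> W2" "max (?l g1) (?l g2)"] ij unfolding I_def i j by blast
    then show "\<exists>k\<in>I. (i, k) \<in> r \<and> (j, k) \<in> r"
      using ij by (intro bexI[of _ "(x, g, W1 \<inter> W2)"]) (auto simp: r_def i j)
  qed
  \<comment> \<open>Inverses enter because \<open>K_set\<close> multiplies by its argument on the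
    right: applied to the exit point \<open>act g x\<close>, the set for \<open>- g\<close> yields
    only points \<open>act s x\<close> with \<open>s\<close> shorter than \<open>g\<close>, all in
    \<open>V\<close>.\<close>
  let ?g = "\<lambda>i :: 'x \<times> 'g \<times> 'x set. - fst (snd i)"
  have "gamma_net \<Gamma> I r ?g"
    unfolding gamma_net_def filterlim_at_top eventually_net_filter[OF I] glength_uminus[OF Gm]
  proof (intro conjI allI I)
    show "\<forall>i\<in>I. ?g i \<noteq> 0"
      using nonzero by (auto simp: I_def)
    show "\<forall>(i, j)\<in>r. ?l (fst (snd i)) \<le> ?l (fst (snd j))"
      by (auto simp: r_def)
    fix n
    obtain x g where "(x, g, UNIV) \<in> I" "n \<le> ?l g"
      using ex[of UNIV n] by auto
    then show "\<exists>i\<in>I. \<forall>j\<in>I. (i, j) \<in> r \<longrightarrow> n \<le> ?l (fst (snd j))"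
      by (intro bexI[of _ "(x, g, UNIV)"]) (auto simp: r_def)
  qed
  then have cone: "gamma_cone \<Gamma> (set_net_limit I r (\<lambda>i. K_set \<Gamma> (?g i)))" (is "gamma_cone \<Gamma> ?C")
    by (rule gamma_coneI)
  \<comment> \<open>Recurrence of \<open>y\<close>, tested on the complement of the closed set
    \<open>V\<close>, gives an element of the cone keeping \<open>y\<close> outside
    \<open>V\<close>.\<close>
  have "\<forall>\<^sub>F w in nhds y. w \<in> - V"
    using y(1) clV by (intro eventually_nhds_in_open) (auto simp: L_def)
  then have "(\<lambda>t. act t y) ` ?C \<inter> - V \<noteq> {}"
    using rec cone unfolding recurrent_type_I_def by blast
  then obtain c where c: "c \<in> ?C" "act c y \<in> - V"
    by blast
  obtain A B where AB: "open A" "open B" "c \<in> A" "y \<in> B"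
      "\<And>a b. a \<in> A \<Longrightarrow> b \<in> B \<Longrightarrow> act a b \<in> - V"
    using act_nhds[OF _ c(2)] clV by (auto simp: open_Compl)
  obtain x0 g0 where i0: "(x0, g0, B) \<in> I"
    using ex[OF AB(2,4)] by blast
  \<comment> \<open>Beyond the index with neighbourhood \<open>B\<close>, every exit point lies in
    \<open>B\<close>, so continuity at \<open>(c, y)\<close> applies to it.\<close>
  obtain k where "k \<in> I" "((x0, g0, B), k) \<in> r" "K_set \<Gamma> (?g k) \<inter> A \<noteq> {}"
    using c(1) AB(1,3) i0 unfolding set_net_limit_iff[OF I] by blast
  then obtain x g W s where k: "(x, g, W) \<in> I" "W \<subseteq> B" "s \<in> set_power \<Gamma> (?l g - 1)" "s + - g \<in> A"
    by (cases k) (auto simp: r_def K_set_def glength_uminus[OF Gm] elim!: set_plus_elim)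
  then have xg: "(x, g) \<in> P" "act g x \<in> B"
    by (auto simp: I_def)
  have "act (s + - g) (act g x) = act s x"
    by (simp only: act_add act_minus)
  then have "act s x \<notin> V"
    using AB(5)[OF k(4) xg(2)] by simp
  then have "?l g \<le> ?l s"
    using xg(1) unfolding P_def by (metis (mono_tags, lifting) case_prodD mem_Collect_eq not_less)
  \<comment> \<open>The length of \<open>g\<close> is now at most itself minus one, which truncated
    subtraction allows only for length 0, that is for \<open>g = 0\<close>.\<close>
  with glength_le[OF k(3)] have "?l g = 0"
    by simp
  then show False
    using set_power_glength[OF \<Gamma>, of g] nonzero[OF xg(1)] by simp
qed

text \<open>Taking \<open>g = 0\<close> puts the set inside \<open>V\<close>, where it is an
  intersection of closed preimages.\<close>

lemma compact_orbit_in: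
  assumes "compact V"
  shows "compact {z. \<forall>g. act g z \<in> V}"
proof -
  have "closed ((act g) -` V)" for g
  proof -
    have "continuous_on UNIV (\<lambda>x. act g x)"
      using continuous_on_compose2[OF continuous_act, of UNIV "\<lambda>x. (g, x)"]
      by (simp add: continuous_on_Pair)
    then show ?thesis
      using compact_imp_closed[OF assms] by (simp add: continuous_on_closed_vimage)
  qed
  then have "closed (\<Inter>g. (act g) -` V)"
    by (intro closed_INT) auto
  then have "compact (V \<inter> (\<Inter>g. (act g) -` V))"
    by (rule compact_Int_closed[OF assms])
  moreover have "V \<inter> (\<Inter>g. (act g) -` V) = {z. \<forall>g. act g z \<in> V}"
    using act_zero by (auto, metis)
  ultimately show ?thesis
    by simp
qed

end

text \<open>Recurrence of a diagonal point is tested on square neighbourhoods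
  \<open>U \<times> U\<close>.\<close>

lemma recurrent_type_I_prodD:
  assumes "recurrent_type_I \<Gamma> (prod_act act) (x, x)"
  shows "recurrent_type_I \<Gamma> act x"
  unfolding recurrent_type_I_def
proof (intro allI impI)
  fix C U assume C: "gamma_cone \<Gamma> C" and U: "\<forall>\<^sub>F y in nhds x. y \<in> U"
  have "\<forall>\<^sub>F p in nhds (x, x). p \<in> U \<times> U"
    unfolding nhds_prod eventually_prod_filter using U by fastforce
  then have "(\<lambda>t. prod_act act t (x, x)) ` C \<inter> U \<times> U \<noteq> {}"
    using assms C unfolding recurrent_type_I_def by blast
  then show "(\<lambda>t. act t x) ` C \<inter> U \<noteq> {}"
    by (auto simp: prod_act_def)
qed

section \<open>Zero-dimensional locally compact spaces\<close>

text \<open>A clopen basis set inside a compact neighbourhood is compact.\<close>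

lemma compact_open_nhd:
  fixes x :: "'x::t2_space"
  assumes "locally_compact_space (euclidean :: 'x topology)" "zero_dimensional TYPE('x)"
    and "open W" "x \<in> W"
  obtains b where "open b" "compact b" "x \<in> b" "b \<subseteq> W"
proof -
  obtain U K where U: "open U" "compact K" "x \<in> U" "U \<subseteq> K"
    using assms(1) unfolding locally_compact_space_def by (auto dest: spec[of _ x])
  obtain B :: "'x set set" where B: "topological_basis B" "\<And>b. b \<in> B \<Longrightarrow> open b \<and> closed b"
    using assms(2) unfolding zero_dimensional_def by blast
  obtain b where b: "b \<in> B" "x \<in> b" "b \<subseteq> U \<inter> W"
    using topological_basisE[OF B(1), of "U \<inter> W" x] U assms(3,4) by blast
  have "compact (K \<inter> b)"
    using U(2) B(2)[OF b(1)] by (intro compact_Int_closed) auto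
  moreover have "K \<inter> b = b"
    using b(3) U(4) by auto
  ultimately show thesis
    using that[of b] b B(2) by auto
qed

lemma compact_open_cover:
  assumes "compact K"
    and nhd: "\<And>x. x \<in> K \<Longrightarrow> \<exists>b. open b \<and> compact b \<and> x \<in> b \<and> b \<subseteq> W"
  obtains V where "open V" "compact V" "K \<subseteq> V" "V \<subseteq> W"
proof -
  obtain b where b: "\<And>x. x \<in> K \<Longrightarrow> open (b x) \<and> compact (b x) \<and> x \<in> b x \<and> b x \<subseteq> W"
    using nhd by metis
  obtain F where F: "F \<subseteq> K" "finite F" "K \<subseteq> (\<Union>x\<in>F. b x)"
    using compactE_image[OF assms(1), of K b] b by blast
  show thesis
    using F b by (intro that[of "\<Union>x\<in>F. b x"] compact_UN) auto
qed

text \<open>Two points of \<open>W\<close> are compared through \<open>x\<close>, using an entourage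
  whose composition square lies in \<open>E\<close> and which relates \<open>x\<close> to
  \<open>W\<close> in both orders.\<close>

lemma eventually_uniformity_square:
  fixes x :: "'x::uniform_space"
  assumes "eventually (\<lambda>p. p \<in> E) uniformity"
  obtains W where "open W" "x \<in> W" "W \<times> W \<subseteq> E"
proof -
  obtain D where D: "eventually D uniformity" "\<And>a b c. D (a, b) \<Longrightarrow> D (b, c) \<Longrightarrow> (a, c) \<in> E"
    using uniformity_transE[OF assms] by blast
  have "eventually (\<lambda>(a, b). D (b, a)) uniformity"
    using D(1) by (rule uniformity_sym)
  with D(1) have "eventually (\<lambda>y. D (x, y) \<and> D (y, x)) (nhds x)"
    unfolding eventually_nhds_uniformity
    by (rule eventually_elim2) auto
  then obtain W where W: "open W" "x \<in> W" "\<And>y. y \<in> W \<Longrightarrow> D (x, y) \<and> D (y, x)"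
    unfolding eventually_nhds by blast
  show thesis
    using W D(2) by (intro that[OF W(1,2)]) blast
qed

section \<open>Product recurrent flows\<close>

locale zero_dimensional_product_recurrent_flow = flow act
  for act :: "'g::{group_add, topological_monoid_add, t2_space}
                \<Rightarrow> 'x::{uniform_space, t2_space} \<Rightarrow> 'x" +
  fixes \<Gamma> :: "'g set"
  assumes generating: "compact_generating_set \<Gamma>"
    and zero_dim: "zero_dimensional TYPE('x)"
    and product_recurrent: "pointwise_product_recurrent \<Gamma> act"
begin

sublocale product: flow "prod_act act"
  using flow_axioms by (rule flow_prod_act)

lemmas compact_open_nhd' = compact_open_nhd[OF locally_compact zero_dim]

lemma product_open_orbit_in:
  assumes "open V" "compact V"
  shows "open {p. \<forall>g. prod_act act g p \<in> V}"
  using product_recurrent unfolding pointwise_product_recurrent_def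
  by (intro product.open_orbit_in[OF generating _ assms]) blast

lemma compact_open_invariant_nhd:
  obtains Y where "open Y" "compact Y" "x \<in> Y" "\<And>g y. y \<in> Y \<Longrightarrow> act g y \<in> Y"
proof -
  obtain V where V: "open V" "compact V" "closure (range (\<lambda>t. act t x)) \<subseteq> V"
  proof (rule compact_open_cover[OF compact_orbit_closure, of x UNIV])
    show "\<exists>b. open b \<and> compact b \<and> y \<in> b \<and> b \<subseteq> UNIV" for y :: 'x
      by (rule compact_open_nhd'[of UNIV y]) auto
  qed blast
  let ?Y = "{z. \<forall>g. act g z \<in> V}"
  have "recurrent_type_I \<Gamma> act z" for z
    using product_recurrent unfolding pointwise_product_recurrent_def
    by (intro recurrent_type_I_prodD[of \<Gamma> act z]) blast
  then have "open ?Y"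
    by (rule open_orbit_in[OF generating _ V(1,2)])
  moreover have "x \<in> ?Y"
    using V(3) closure_subset[of "range (\<lambda>t. act t x)"] by blast
  moreover have "act g y \<in> ?Y" if "y \<in> ?Y" for g y
    using that by (simp flip: act_add)
  ultimately show thesis
    using that[of ?Y] compact_orbit_in[OF V(2)] by blast
qed

lemma equicontinuous: "equicontinuous_action act"
  unfolding equicontinuous_action_def
proof (intro allI impI)
  fix x :: 'x and E :: "('x \<times> 'x) set"
  assume E: "eventually (\<lambda>p. p \<in> E) uniformity"
  obtain Y where Y: "open Y" "compact Y" "x \<in> Y" "\<And>g y. y \<in> Y \<Longrightarrow> act g y \<in> Y"
    using compact_open_invariant_nhd by blast
  have "continuous_on Y (\<lambda>y. (y, y))"
    by (intro continuous_intros)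
  then have "compact ((\<lambda>y. (y, y)) ` Y)"
    using Y(2) by (rule compact_continuous_image)
  then obtain V where V: "open V" "compact V" "(\<lambda>y. (y, y)) ` Y \<subseteq> V" "V \<subseteq> E"
  proof (rule compact_open_cover)
    fix p :: "'x \<times> 'x" assume "p \<in> (\<lambda>y. (y, y)) ` Y"
    then obtain y where p: "p = (y, y)"
      by blast
    obtain W where W: "open W" "y \<in> W" "W \<times> W \<subseteq> E"
      using eventually_uniformity_square[OF E] by blast
    obtain b where "open b" "compact b" "y \<in> b" "b \<subseteq> W"
      by (rule compact_open_nhd'[OF W(1,2)])
    then show "\<exists>b. open b \<and> compact b \<and> p \<in> b \<and> b \<subseteq> E"
      using W(3) by (intro exI[of _ "b \<times> b"]) (auto simp: p open_Times compact_Times)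
  qed blast
  let ?S = "{p. \<forall>g. prod_act act g p \<in> V}"
  \<comment> \<open>The orbit of \<open>(x, x)\<close> stays on the diagonal of \<open>Y\<close>,
    inside \<open>V\<close>. Openness of \<open>?S\<close> then gives a box around
    \<open>(x, x)\<close>, whose slice over \<open>x\<close> is the estimate uniform in
    \<open>g\<close>.\<close>
  have "(x, x) \<in> ?S"
    using Y(3,4) V(3) by (auto simp: prod_act_def)
  then obtain A B where AB: "open A" "open B" "x \<in> A" "x \<in> B" "A \<times> B \<subseteq> ?S"
    by (rule open_prod_elim[OF product_open_orbit_in[OF V(1,2)]]) blast
  have "act g ` B \<subseteq> E `` {act g x}" for g
  proof
    fix w assume "w \<in> act g ` B"
    then obtain b where b: "b \<in> B" "w = act g b" by blast
    then have "(x, b) \<in> ?S" using AB by blast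
    then have "prod_act act g (x, b) \<in> V" by blast
    then show "w \<in> E `` {act g x}"
      using V(4) b(2) by (auto simp: prod_act_def)
  qed
  moreover have "\<forall>\<^sub>F y in nhds x. y \<in> B"
    using AB by (intro eventually_nhds_in_open)
  ultimately show "\<exists>U. (\<forall>\<^sub>F y in nhds x. y \<in> U) \<and> (\<forall>g. act g ` U \<subseteq> E `` {act g x})"
    by blast
qed

text \<open>The classes are open, so compactness leaves finitely many. The group permutes them with
  kernel \<open>H\<close>, which is therefore normal of finite index, hence syndetic.\<close>

lemma invariant_equiv_kernel:
  assumes Y: "compact Y" "\<And>g y. y \<in> Y \<Longrightarrow> act g y \<in> Y"
    and R: "open R" "equiv Y R" "\<And>g a b. (a, b) \<in> R \<Longrightarrow> (act g a, act g b) \<in> R"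
  defines "H \<equiv> {h. \<forall>y\<in>Y. (y, act h y) \<in> R}"
  shows "H \<lhd> group_of_type" "syndetic H"
proof -
  have rf: "\<And>y. y \<in> Y \<Longrightarrow> (y, y) \<in> R"
    and sy: "\<And>a b. (a, b) \<in> R \<Longrightarrow> (b, a) \<in> R"
    and tr: "\<And>a b c. (a, b) \<in> R \<Longrightarrow> (b, c) \<in> R \<Longrightarrow> (a, c) \<in> R"
    using R(2) unfolding equiv_def refl_on_def by (blast dest: symD transD)+
  interpret G: group "group_of_type :: 'g monoid"
    by (rule group_group_of_type)
  have inv: "inv\<^bsub>group_of_type\<^esub> g = - g" for g :: 'g
    by (rule G.inv_equality) (auto simp: group_of_type_def)
  have H0: "0 \<in> H"
    using rf by (simp add: H_def act_zero)
  have Hadd: "a + b \<in> H" if "a \<in> H" "b \<in> H" for a b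
    using that Y(2) by (auto simp: H_def act_add intro: tr)
  have Hminus: "- a \<in> H" if "a \<in> H" for a
  proof -
    have "(y, act (- a) y) \<in> R" if "y \<in> Y" for y
    proof -
      have "\<forall>y\<in>Y. (y, act a y) \<in> R"
        using \<open>a \<in> H\<close> by (simp add: H_def)
      from bspec[OF this Y(2)[OF that, of "- a"]] have "(act (- a) y, y) \<in> R"
        by simp
      then show ?thesis
        by (rule sy)
    qed
    then show ?thesis
      by (simp add: H_def)
  qed
  have Hconj: "g + h + - g \<in> H" if "h \<in> H" for g h
  proof -
    have "(y, act (g + h + - g) y) \<in> R" if "y \<in> Y" for y
    proof -
      have "(act (- g) y, act h (act (- g) y)) \<in> R"
        using \<open>h \<in> H\<close> Y(2)[OF that] by (simp add: H_def)
      from R(3)[OF this, of g] show ?thesis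
        by (simp only: act_add act_minus)
    qed
    then show ?thesis
      by (simp add: H_def)
  qed
  have "subgroup H group_of_type"
    using H0 Hadd Hminus
    by (intro G.subgroupI) (auto simp: inv, auto simp: group_of_type_def)
  then show "H \<lhd> group_of_type"
    using Hconj unfolding G.normal_inv_iff by (simp add: inv) (simp add: group_of_type_def)

  have opn: "open (R `` {y})" for y
    unfolding open_subopen[of "R `` {y}"]
  proof
    fix w assume "w \<in> R `` {y}"
    then have "(y, w) \<in> R" by blast
    then obtain A B where "open A" "open B" "y \<in> A" "w \<in> B" "A \<times> B \<subseteq> R"
      by (rule open_prod_elim[OF R(1)]) blast
    then show "\<exists>T. open T \<and> w \<in> T \<and> T \<subseteq> R `` {y}"
      by blast
  qed
  obtain S where S: "S \<subseteq> Y" "finite S" "Y \<subseteq> (\<Union>s\<in>S. R `` {s})"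
    using compactE_image[OF Y(1), of Y "\<lambda>y. R `` {y}"] opn rf by blast
  have "\<forall>y\<in>Y. \<exists>s. s \<in> S \<and> (s, y) \<in> R"
    using S(3) by blast
  \<comment> \<open>Equivalent points may get different values of \<open>c\<close>, as
    \<open>S\<close> may meet a class twice; but equal values force equivalence. So
    \<open>f k = f g\<close> means that \<open>k\<close> and \<open>g\<close> act alike on classes,
    and \<open>f\<close> has finitely many values.\<close>
  then obtain c where c: "\<And>y. y \<in> Y \<Longrightarrow> c y \<in> S \<and> (c y, y) \<in> R"
    unfolding bchoice_iff by blast
  define f where "f g = restrict (\<lambda>s. c (act g s)) S" for g
  have "f g \<in> S \<rightarrow>\<^sub>E S" for g
    using c S(1) Y(2) by (auto simp: f_def)
  then have "finite (range f)"
    by (intro finite_subset[OF _ finite_PiE[OF S(2), of "\<lambda>_. S"]] S(2)) auto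
  then obtain K where K: "finite K" "range f = f ` K"
    using finite_subset_image[of "range f" f UNIV] by blast
  have "g \<in> K + H" for g
  proof -
    obtain k where k: "k \<in> K" "f k = f g"
      using K(2) by (metis imageE rangeI)
    have "(y, act (- k + g) y) \<in> R" if "y \<in> Y" for y
    proof -
      define s where "s = c y"
      have s: "s \<in> S" "s \<in> Y" "(s, y) \<in> R"
        using c[OF that] S(1) by (auto simp: s_def)
      have "c (act k s) = c (act g s)"
        using fun_cong[OF k(2), of s] s(1) by (simp add: f_def)
      then have "(act k s, act g s) \<in> R"
        using c[OF Y(2)[OF s(2)]] by (metis sy tr)
      then have "(act k y, act g y) \<in> R"
        using R(3)[OF s(3)] by (meson sy tr)
      from R(3)[OF this, of "- k"] show ?thesis
        by (simp only: act_add act_minus)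
    qed
    then have "k + (- k + g) \<in> K + H"
      using k(1) by (intro set_plus_intro) (simp_all add: H_def)
    then show ?thesis
      by simp
  qed
  \<comment> \<open>The definition of syndetic inverts its compact set, so the inverses of
    \<open>K\<close> are supplied.\<close>
  then have "UNIV = uminus ` uminus ` K + H"
    by (auto simp: image_image)
  then show "syndetic H"
    unfolding syndetic_def using finite_imp_compact[of "uminus ` K"] K(1) by blast
qed

lemma regularly_almost_periodic: "regularly_almost_periodic act x"
  unfolding regularly_almost_periodic_def
proof (intro allI impI)
  fix U assume "\<forall>\<^sub>F y in nhds x. y \<in> U"
  then obtain U' where U': "open U'" "x \<in> U'" "U' \<subseteq> U"
    by (auto simp: eventually_nhds)
  obtain Y where Y: "open Y" "compact Y" "x \<in> Y" "\<And>g y. y \<in> Y \<Longrightarrow> act g y \<in> Y"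
    using compact_open_invariant_nhd by blast
  obtain b where b: "open b" "compact b" "x \<in> b" "b \<subseteq> Y \<inter> U'"
    by (rule compact_open_nhd'[of "Y \<inter> U'" x]) (use Y U' in auto)
  \<comment> \<open>\<open>V\<close> is the relation of lying in the same piece of the clopen
    partition of \<open>Y\<close> into \<open>b\<close> and \<open>Y - b\<close>; \<open>R\<close>
    inherits from it the laws of an equivalence.\<close>
  define V where "V = b \<times> b \<union> (Y - b) \<times> (Y - b)"
  define R where "R = {p. \<forall>g. prod_act act g p \<in> V}"
  have V: "open V" "compact V"
    unfolding V_def using b Y
    by (auto intro!: open_Un open_Times compact_Un compact_Times open_Diff compact_diff
        compact_imp_closed)
  have R_iff: "(y, z) \<in> R \<longleftrightarrow> (\<forall>g. (act g y, act g z) \<in> V)" for y z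
    by (simp add: R_def prod_act_def)
  have RV: "R \<subseteq> V"
    using R_iff[of _ _] by (metis act_zero subrelI)
  have "equiv Y R"
  proof (rule equivI)
    show "R \<subseteq> Y \<times> Y"
      using RV b(4) by (auto simp: V_def)
    show "refl_on Y R"
      using Y(4) by (auto simp: refl_on_def R_iff V_def)
    show "sym R"
      by (auto simp: sym_def R_iff V_def)
    show "trans R"
      by (rule transI) (force simp: R_iff V_def)
  qed
  moreover have "open R"
    unfolding R_def by (rule product_open_orbit_in[OF V])
  moreover have "(act g y, act g z) \<in> R" if "(y, z) \<in> R" for g y z
    using that by (simp add: R_iff flip: act_add)
  ultimately have "{h. \<forall>y\<in>Y. (y, act h y) \<in> R} \<lhd> group_of_type"
      "syndetic {h. \<forall>y\<in>Y. (y, act h y) \<in> R}"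
    using invariant_equiv_kernel[OF Y(2,4)] by blast+
  moreover have "{h. \<forall>y\<in>Y. (y, act h y) \<in> R} \<subseteq> return_set act x U"
  proof
    fix h assume "h \<in> {h. \<forall>y\<in>Y. (y, act h y) \<in> R}"
    \<comment> \<open>Since \<open>x\<close> lies in \<open>b\<close>, its partner
      \<open>act h x\<close> must lie in the same piece \<open>b\<close>, which is inside
      \<open>U\<close>.\<close>
    then have "(x, act h x) \<in> V"
      using Y(3) RV by blast
    then show "h \<in> return_set act x U"
      using b U'(3) by (auto simp: V_def return_set_def)
  qed
  ultimately show "\<exists>H. H \<lhd> group_of_type \<and> syndetic H \<and> H \<subseteq> return_set act x U"
    by blast
qed

end

theorem theoremB:
  fixes act :: "'g::{group_add, topological_monoid_add, t2_space}
                  \<Rightarrow> 'x::{uniform_space, t2_space} \<Rightarrow> 'x"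
    and \<Gamma> :: "'g set"
  assumes "flow act"
    and "compact_generating_set \<Gamma>"
    and "zero_dimensional TYPE('x)"
    and "pointwise_product_recurrent \<Gamma> act"
  shows "pointwise_regularly_almost_periodic act \<and> equicontinuous_action act"
proof -
  interpret zero_dimensional_product_recurrent_flow act \<Gamma>
    using assms by (intro zero_dimensional_product_recurrent_flow.intro
        zero_dimensional_product_recurrent_flow_axioms.intro)
  show ?thesis
    using equicontinuous regularly_almost_periodic
    by (simp add: pointwise_regularly_almost_periodic_def)
qed

end
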